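(* Let $\mathcal H$ be a Hilbert space, $f_\rho\in\mathcal H$, $\kappa>0$, and let $\Lambda=\{\lambda_0,\dots,\lambda_m\}$, $m\ge 1$, be a finite grid with $\kappa^2\ge\lambda_0>\lambda_1>\dots>\lambda_m=\lambda_{\min}>0$. Let $A$ be a bounded positive self-adjoint operator on $\mathcal H$, let $C>0$, let $\mathcal A:[0,\kappa^2]\to\mathbb R_+$ be non-decreasing with $\mathcal A(0)=0$, and let $\mathcal S$ be a nonnegative function on $[0,\kappa^2]$ such that $\lambda\mapsto\sqrt\lambda\,\mathcal S(\lambda)\in\mathbb R_+$ is non-increasing. Suppose that for every $\lambda\in\Lambda$ there is an element $f^\lambda\in\mathcal H$ with $$\big\|(A+\lambda)^{1/2}(f_\rho-f^\lambda)\big\|_{\mathcal H}\le C\sqrt\lambda\,\big(\mathcal A(\lambda)+\mathcal S(\lambda)\big).$$ Define $$\mathcal M(\Lambda):=\Big\{\lambda\in\Lambda:\ \big\|(A+\lambda')^{1/2}(f^\lambda-f^{\lambda'})\big\|_{\mathcal H}\le 4C\sqrt{\lambda'}\,\mathcal S(\lambda')\ \ \text{for all }\lambda'\in\Lambda\text{ with }\lambda'\le\lambda\Big\},\qquad \hat\lambda:=\max\mathcal M(\Lambda),$$ $$\lambda_*:=\max\big(\{\lambda\in\Lambda:\ \mathcal A(\lambda)\le\mathcal S(\lambda)\}\cup\{\lambda_{\min}\}\big),\qquad \widetilde{\mathcal S}(\lambda_* ):=\max\big(\mathcal S(\lambda_* ),\mathcal A(\lambda_* )\big).$$ Then: (1)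 $\hat\lambda\ge\lambda_*$, and $$\big\|(A+\lambda_* )^{1/2}(f_\rho-f^{\hat\lambda})\big\|_{\mathcal H}\le 6C\sqrt{\lambda_*}\,\widetilde{\mathcal S}(\lambda_* ).$$ (2) If there is a constant $C_{\mathcal S}>1$ such that $\mathcal S(\lambda_k)\le C_{\mathcal S}\,\mathcal S(\lambda_{k-1})$ for $k=1,\dots,m$, then for every $s\in[0,\tfrac12]$, $$\lambda_*^s\,\widetilde{\mathcal S}(\lambda_* )\le C_{\mathcal S}\inf_{\lambda\in[\lambda_{\min},\lambda_0]}\Big\{\lambda^s\big(\mathcal A(\lambda)+\mathcal S(\lambda)\big)\Big\}.$$
   Context: "Positive" means nonnegative: $\langle Ah,h\rangle\ge0$ for all $h$. Powers of operators are defined by the spectral calculus. $A+\lambda$ means $A+\lambda I$. The set $\mathcal M(\Lambda)$ is nonempty since it contains $\lambda_{\min}$ (because $\mathcal S\geq 0$). *)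

theory Defs
  imports "HOL-Analysis.Analysis" "HOL-Computational_Algebra.Polynomial"
begin

definition op_self_adjoint :: "('a::real_inner \<Rightarrow>\<^sub>L 'a) \<Rightarrow> bool" where
  "op_self_adjoint A \<longleftrightarrow> (\<forall>x y. blinfun_apply A x \<bullet> y = x \<bullet> blinfun_apply A y)"

definition op_positive :: "('a::real_inner \<Rightarrow>\<^sub>L 'a) \<Rightarrow> bool" where
  "op_positive A \<longleftrightarrow> (\<forall>h. 0 \<le> blinfun_apply A h \<bullet> h)"

definition op_invertible :: "('a::real_normed_vector \<Rightarrow>\<^sub>L 'a) \<Rightarrow> bool" where
  "op_invertible A \<longleftrightarrow> (\<exists>B. B o\<^sub>L A = id_blinfun \<and> A o\<^sub>L B = id_blinfun)"

(* Real spectral values only; for a self-adjoint operator this is the whole spectrum. *)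
definition op_spectrum :: "('a::real_normed_vector \<Rightarrow>\<^sub>L 'a) \<Rightarrow> real set" where
  "op_spectrum A = {x. \<not> op_invertible (A - x *\<^sub>R id_blinfun)}"

definition op_power :: "('a::real_normed_vector \<Rightarrow>\<^sub>L 'a) \<Rightarrow> nat \<Rightarrow> ('a \<Rightarrow>\<^sub>L 'a)" where
  "op_power A n = ((\<lambda>B. A o\<^sub>L B) ^^ n) id_blinfun"

definition op_poly :: "real poly \<Rightarrow> ('a::real_normed_vector \<Rightarrow>\<^sub>L 'a) \<Rightarrow> ('a \<Rightarrow>\<^sub>L 'a)" where
  "op_poly p A = (\<Sum>i\<le>degree p. coeff p i *\<^sub>R op_power A i)"

(* Continuous spectral calculus: g(A) is the operator-norm limit of p_n(A) for real polynomials
   p_n converging to g uniformly on the spectrum. For A self-adjoint on a Hilbert space and g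
   continuous on the spectrum, such p_n exist by Weierstrass and the limit does not depend on
   them because the norm of p(A) is the maximum of |p| on the spectrum.
   Otherwise the value carries no meaning. *)
definition op_fun :: "(real \<Rightarrow> real) \<Rightarrow> ('a::real_normed_vector \<Rightarrow>\<^sub>L 'a) \<Rightarrow> ('a \<Rightarrow>\<^sub>L 'a)" where
  "op_fun g A = (THE T. \<exists>p :: nat \<Rightarrow> real poly.
      uniform_limit (op_spectrum A) (\<lambda>n. poly (p n)) g sequentially \<and>
      (\<lambda>n. op_poly (p n) A) \<longlonglongrightarrow> T)"

(* Intended for positive self-adjoint A and s > 0; 0 powr 0 = 0 makes s = 0 a special case. *)
definition op_powr :: "('a::real_normed_vector \<Rightarrow>\<^sub>L 'a) \<Rightarrow> real \<Rightarrow> ('a \<Rightarrow>\<^sub>L 'a)" where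
  "op_powr A s = op_fun (\<lambda>x. x powr s) A"

definition admissible_set ::
  "('a::real_inner \<Rightarrow>\<^sub>L 'a) \<Rightarrow> real \<Rightarrow> (real \<Rightarrow> real) \<Rightarrow> (real \<Rightarrow> 'a) \<Rightarrow> real set \<Rightarrow> real set" where
  "admissible_set A C S f \<Lambda> =
     {l \<in> \<Lambda>. \<forall>l' \<in> \<Lambda>. l' \<le> l \<longrightarrow>
        norm (blinfun_apply (op_powr (A + l' *\<^sub>R id_blinfun) (1/2)) (f l - f l'))
          \<le> 4 * C * sqrt l' * S l'}"

definition lambda_hat ::
  "('a::real_inner \<Rightarrow>\<^sub>L 'a) \<Rightarrow> real \<Rightarrow> (real \<Rightarrow> real) \<Rightarrow> (real \<Rightarrow> 'a) \<Rightarrow> real set \<Rightarrow> real" where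
  "lambda_hat A C S f \<Lambda> = Max (admissible_set A C S f \<Lambda>)"

definition lambda_star :: "(real \<Rightarrow> real) \<Rightarrow> (real \<Rightarrow> real) \<Rightarrow> real set \<Rightarrow> real" where
  "lambda_star App S \<Lambda> = Max ({l \<in> \<Lambda>. App l \<le> S l} \<union> {Min \<Lambda>})"

definition S_tilde :: "(real \<Rightarrow> real) \<Rightarrow> (real \<Rightarrow> real) \<Rightarrow> real \<Rightarrow> real" where
  "S_tilde App S l = max (S l) (App l)"

end

theory Submission
  imports Defs "HOL-Computational_Algebra.Fundamental_Theorem_Algebra"
begin

text \<open>For self-adjoint \<open>A\<close> the bound \<open>\<parallel>q(A)\<parallel> \<le> sup {|q x|. x \<in> op_spectrum A}\<close> holds for
  every real polynomial \<open>q\<close>: one of \<open>\<plusminus>\<parallel>q(A)\<parallel>\<close> is a spectral value \<open>c\<close> of \<open>q(A)\<close>, and \<open>q - c\<close>, factored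
  over the reals, must vanish on the spectrum of \<open>A\<close>, because its quadratic factors give coercive
  and hence invertible operators. So the spectral calculus is well defined and
  \<open>\<parallel>(A + l)\<^sup>1\<^sup>/\<^sup>2 x\<parallel>\<^sup>2 = \<langle>A x, x\<rangle> + l \<parallel>x\<parallel>\<^sup>2\<close>, which is monotone in \<open>l\<close>. What remains is Lepskii's argument:
  below \<open>\<lambda>\<^sub>*\<close> the approximation term is dominated by the stochastic term, so \<open>\<lambda>\<^sub>*\<close> is admissible, and
  the triangle inequality through \<open>f \<lambda>\<^sub>*\<close> gives the error bound.\<close>

section \<open>Criteria for invertibility\<close>

text \<open>The lower bound gives injectivity, so the right inverse chosen from surjectivity is
  linear; the same bound limits its norm by \<open>1 / c\<close>.\<close>

lemma op_invertible_if_bounded_below_surj: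
  fixes P :: "'a::real_normed_vector \<Rightarrow>\<^sub>L 'a"
  assumes "c > 0" and below: "\<And>x. c * norm x \<le> norm (P x)" and surj: "\<And>y. \<exists>x. P x = y"
  shows "op_invertible P"
proof -
  have inj: "x = y" if "P x = P y" for x y
  proof -
    have "c * norm (x - y) \<le> 0"
      using below[of "x - y"] that by (simp add: blinfun.diff_right)
    then show ?thesis using \<open>c > 0\<close> by (simp add: mult_le_0_iff)
  qed
  obtain g where g: "\<And>y. P (g y) = y" using surj by metis
  have "bounded_linear g"
  proof (rule bounded_linear_intro)
    show "g (x + y) = g x + g y" for x y
      by (rule inj) (simp add: g blinfun.add_right)
    show "g (r *\<^sub>R x) = r *\<^sub>R g x" for r x
      by (rule inj) (simp add: g blinfun.scaleR_right)
    show "norm (g x) \<le> norm x * (1 / c)" for x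
      using below[of "g x"] \<open>c > 0\<close> by (simp add: g field_simps)
  qed
  moreover have "g (P x) = x" for x by (rule inj) (simp add: g)
  ultimately have "P o\<^sub>L Blinfun g = id_blinfun" "Blinfun g o\<^sub>L P = id_blinfun"
    by (auto intro!: blinfun_eqI simp: bounded_linear_Blinfun_apply g)
  then show ?thesis unfolding op_invertible_def by blast
qed

text \<open>For small \<open>t > 0\<close> the map \<open>x \<mapsto> x - t (P x - y)\<close> is a contraction whose fixed point solves
  \<open>P x = y\<close>.\<close>
lemma op_invertible_if_coercive:
  fixes P :: "'a::{real_inner, complete_space} \<Rightarrow>\<^sub>L 'a"
  assumes "c > 0" and coercive: "\<And>x. c * (norm x)\<^sup>2 \<le> P x \<bullet> x"
  shows "op_invertible P"
proof (rule op_invertible_if_bounded_below_surj[OF \<open>c > 0\<close>])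
  show "c * norm x \<le> norm (P x)" for x
  proof (cases "x = 0")
    case False
    have "c * norm x * norm x \<le> norm (P x) * norm x"
      using coercive[of x] norm_cauchy_schwarz[of "P x" x] by (simp add: power2_eq_square)
    then show ?thesis using False by simp
  qed simp
next
  fix y
  \<comment> \<open>\<open>t = c / K\<close> minimises \<open>1 - 2 * t * c + t^2 * K\<close>, and
    \<open>q\<close> is the minimum. The summand \<open>c^2\<close> in \<open>K\<close> guarantees
    \<open>K > 0\<close> and \<open>q \<ge> 0\<close>.\<close>
  define K where "K = (norm P)\<^sup>2 + c\<^sup>2"
  define t where "t = c / K"
  define q where "q = 1 - c\<^sup>2 / K"
  have K: "K > 0" "c\<^sup>2 \<le> K" using \<open>c > 0\<close> by (auto simp: K_def intro: add_nonneg_pos)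
  have t: "t > 0" using \<open>c > 0\<close> K by (simp add: t_def)
  have q: "0 \<le> q" "q < 1" using K \<open>c > 0\<close> by (auto simp: q_def)
  have tK: "2 * t * c - t\<^sup>2 * K = c\<^sup>2 / K"
    using K by (simp add: t_def power2_eq_square field_simps)
  have bound: "norm (x - t *\<^sub>R P x) \<le> sqrt q * norm x" for x
  proof -
    have "(norm (P x))\<^sup>2 \<le> (norm P * norm x)\<^sup>2"
      by (intro power_mono norm_blinfun) simp
    also have "\<dots> \<le> K * (norm x)\<^sup>2"
      by (simp add: K_def power_mult_distrib algebra_simps)
    finally have PK: "(norm (P x))\<^sup>2 \<le> K * (norm x)\<^sup>2" .
    have "(norm (x - t *\<^sub>R P x))\<^sup>2 = (norm x)\<^sup>2 - 2 * t * (P x \<bullet> x) + t\<^sup>2 * (norm (P x))\<^sup>2"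
      unfolding power2_norm_eq_inner
      by (simp add: inner_diff_left inner_diff_right inner_commute algebra_simps power2_eq_square)
    also have "\<dots> \<le> (norm x)\<^sup>2 - 2 * t * (c * (norm x)\<^sup>2) + t\<^sup>2 * (K * (norm x)\<^sup>2)"
      using t coercive[of x] PK by (intro add_mono diff_mono mult_left_mono) auto
    also have "\<dots> = (norm x)\<^sup>2 - (2 * t * c - t\<^sup>2 * K) * (norm x)\<^sup>2"
      by (simp add: algebra_simps)
    also have "\<dots> = q * (norm x)\<^sup>2" unfolding tK by (simp add: q_def algebra_simps)
    finally have "(norm (x - t *\<^sub>R P x))\<^sup>2 \<le> (sqrt q * norm x)\<^sup>2"
      using q by (simp add: power_mult_distrib)
    then show ?thesis using q by (simp add: power2_le_iff_abs_le)
  qed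
  have "\<exists>!x. x - t *\<^sub>R (P x - y) = x"
  proof (rule banach_fix_type)
    show "0 \<le> sqrt q" "sqrt q < 1" using q by auto
    have "x - t *\<^sub>R (P x - y) - (z - t *\<^sub>R (P z - y)) = (x - z) - t *\<^sub>R P (x - z)" for x z
      by (simp add: blinfun.diff_right scaleR_diff_right)
    then show "\<forall>x z. dist (x - t *\<^sub>R (P x - y)) (z - t *\<^sub>R (P z - y)) \<le> sqrt q * dist x z"
      unfolding dist_norm using bound by metis
  qed
  then show "\<exists>x. P x = y" using t by auto
qed

lemma op_invertible_compose:
  assumes "op_invertible P" "op_invertible Q"
  shows "op_invertible (P o\<^sub>L Q)"
proof -
  obtain P' Q' where "P' o\<^sub>L P = id_blinfun" "P o\<^sub>L P' = id_blinfun"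
    "Q' o\<^sub>L Q = id_blinfun" "Q o\<^sub>L Q' = id_blinfun"
    using assms unfolding op_invertible_def by blast
  then have "P' (P x) = x" "P (P' x) = x" "Q' (Q x) = x" "Q (Q' x) = x" for x
    by (metis blinfun_apply_blinfun_compose blinfun_apply_id_blinfun id_apply)+
  then have "(Q' o\<^sub>L P') o\<^sub>L (P o\<^sub>L Q) = id_blinfun" "(P o\<^sub>L Q) o\<^sub>L (Q' o\<^sub>L P') = id_blinfun"
    by (auto intro!: blinfun_eqI)
  then show ?thesis unfolding op_invertible_def by blast
qed

section \<open>Algebra of operator polynomials\<close>

text \<open>Padding with zero coefficients avoids a case distinction in the recursion for
  \<open>pCons a p\<close>, whose degree is \<open>Suc (degree p)\<close> only for nonzero
  \<open>p\<close>.\<close>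

lemma op_poly_eq_sum:
  assumes "degree p \<le> n"
  shows "op_poly p A = (\<Sum>i\<le>n. coeff p i *\<^sub>R op_power A i)"
  unfolding op_poly_def
  by (rule sum.mono_neutral_left) (use assms in \<open>auto simp: coeff_eq_0\<close>)

lemma op_power_simps [simp]:
  "op_power A 0 = id_blinfun" "op_power A (Suc n) = A o\<^sub>L op_power A n"
  by (simp_all add: op_power_def)

lemma op_poly_0 [simp]: "op_poly 0 A = 0"
  by (simp add: op_poly_def)

text \<open>This Horner recursion lets the algebraic laws be proved by induction over
  \<open>pCons\<close>; through them a factorisation of a polynomial becomes one of the
  operator.\<close>

lemma op_poly_pCons:
  "op_poly (pCons a p) A = a *\<^sub>R id_blinfun + (A o\<^sub>L op_poly p A)"
proof -
  have "op_poly (pCons a p) A = (\<Sum>i\<le>Suc (degree p). coeff (pCons a p) i *\<^sub>R op_power A i)"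
    by (rule op_poly_eq_sum) (rule degree_pCons_le)
  also have "\<dots> = a *\<^sub>R id_blinfun + (\<Sum>i\<le>degree p. coeff p i *\<^sub>R (A o\<^sub>L op_power A i))"
    by (subst sum.atMost_Suc_shift) simp
  also have "(\<Sum>i\<le>degree p. coeff p i *\<^sub>R (A o\<^sub>L op_power A i)) = A o\<^sub>L op_poly p A"
    by (rule blinfun_eqI) (simp add: op_poly_def blinfun.bilinear_simps blinfun.sum_left blinfun.sum_right)
  finally show ?thesis .
qed

lemma op_poly_add: "op_poly (p + q) A = op_poly p A + op_poly q A"
proof (induction p q rule: poly_induct2)
  case (pCons a p b q)
  then show ?case
    by (auto intro!: blinfun_eqI simp: op_poly_pCons blinfun.bilinear_simps algebra_simps)
qed simp

lemma op_poly_smult: "op_poly (smult c p) A = c *\<^sub>R op_poly p A"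
  by (induction p)
     (auto intro!: blinfun_eqI simp: op_poly_pCons blinfun.bilinear_simps algebra_simps)

lemma op_poly_diff: "op_poly (p - q) A = op_poly p A - op_poly q A"
  using op_poly_add[of "p - q" q A] by simp

lemma op_poly_mult: "op_poly (p * q) A = op_poly p A o\<^sub>L op_poly q A"
proof (induction p)
  case (pCons a p)
  then show ?case
    by (auto intro!: blinfun_eqI
        simp: op_poly_pCons op_poly_add op_poly_smult blinfun.bilinear_simps)
qed simp

lemma op_poly_X: "op_poly [:0, 1:] A = A"
  by (rule blinfun_eqI) (simp add: op_poly_pCons blinfun.bilinear_simps)

section \<open>Spectral bound for polynomials of a self-adjoint operator\<close>

text \<open>A product of commuting self-adjoint operators is self-adjoint, and \<open>A\<close>
  commutes with its own polynomials.\<close>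

lemma op_self_adjoint_op_poly:
  assumes "op_self_adjoint A"
  shows "op_self_adjoint (op_poly p A)"
proof (induction p)
  case 0
  then show ?case by (simp add: op_self_adjoint_def)
next
  case (pCons a p)
  have comm: "A o\<^sub>L op_poly p A = op_poly p A o\<^sub>L A"
    by (metis mult.commute op_poly_X op_poly_mult)
  have "A (op_poly p A x) \<bullet> y = x \<bullet> A (op_poly p A y)" for x y
  proof -
    have "A (op_poly p A x) \<bullet> y = x \<bullet> op_poly p A (A y)"
      using assms pCons.IH unfolding op_self_adjoint_def by metis
    also have "op_poly p A (A y) = A (op_poly p A y)"
      using comm by (metis blinfun_apply_blinfun_compose)
    finally show ?thesis .
  qed
  then show ?case
    by (simp add: op_self_adjoint_def op_poly_pCons blinfun.bilinear_simps inner_add_left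
        inner_add_right)
qed

text \<open>If \<open>T\<^sup>2 - n\<^sup>2\<close> with \<open>n = \<parallel>T\<parallel>\<close> were bounded below, then
  \<open>\<parallel>T\<^sup>2 x - n\<^sup>2 x\<parallel>\<^sup>2 \<le> 2 n\<^sup>2 (n\<^sup>2 \<parallel>x\<parallel>\<^sup>2 - \<parallel>T x\<parallel>\<^sup>2)\<close> would make the norm of \<open>T\<close> smaller than \<open>n\<close>.\<close>
lemma norm_in_op_spectrum:
  fixes T :: "'a::real_inner \<Rightarrow>\<^sub>L 'a"
  assumes sa: "op_self_adjoint T" and nontrivial: "(v :: 'a) \<noteq> 0"
  shows "\<exists>c \<in> op_spectrum T. \<bar>c\<bar> = norm T"
proof (cases "T = 0")
  case True
  have "\<not> op_invertible (0 :: 'a \<Rightarrow>\<^sub>L 'a)"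
  proof
    assume "op_invertible (0 :: 'a \<Rightarrow>\<^sub>L 'a)"
    then obtain R :: "'a \<Rightarrow>\<^sub>L 'a" where "0 o\<^sub>L R = id_blinfun"
      unfolding op_invertible_def by blast
    then have "(0 o\<^sub>L R) v = id_blinfun v" by simp
    then have "v = 0" unfolding blinfun_apply_blinfun_compose by simp
    with nontrivial show False by blast
  qed
  with True show ?thesis by (auto simp: op_spectrum_def)
next
  case False
  define n where "n = norm T"
  have n: "n > 0" using False by (simp add: n_def)
  \<comment> \<open>The composite is \<open>T^2 - n^2\<close>. If it is not invertible, one of its
    factors is not, which puts \<open>n\<close> or \<open>- n\<close> in the spectrum.\<close>
  have "\<not> op_invertible ((T - n *\<^sub>R id_blinfun) o\<^sub>L (T - (- n) *\<^sub>R id_blinfun))" (is "\<not> op_invertible ?P")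
  proof
    assume "op_invertible ?P"
    then obtain R where R: "R o\<^sub>L ?P = id_blinfun" unfolding op_invertible_def by blast
    define r where "r = norm R + 1"
    have r: "r > 0" by (simp add: r_def add_nonneg_pos)
    \<comment> \<open>\<open>d\<close> is the reciprocal of the factor in the estimate below. It is
      the uniform gap in \<open>|T x|^2 \<le> (n^2 - d) |x|^2\<close>, which contradicts
      \<open>n = norm T\<close>.\<close>
    define d where "d = 1 / (2 * n\<^sup>2 * r\<^sup>2)"
    have d: "d > 0" using n r by (simp add: d_def)
    have Tx: "(norm (T x))\<^sup>2 \<le> (n\<^sup>2 - d) * (norm x)\<^sup>2" for x
    proof -
      have P: "?P x = T (T x) - n\<^sup>2 *\<^sub>R x"
        by (simp add: blinfun.bilinear_simps power2_eq_square algebra_simps)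
      have "(norm (?P x))\<^sup>2
          = (norm (T (T x)))\<^sup>2 - 2 * n\<^sup>2 * (T (T x) \<bullet> x) + n^4 * (norm x)\<^sup>2"
        unfolding P power2_norm_eq_inner
        by (simp add: inner_diff_left inner_diff_right inner_commute algebra_simps power2_eq_square
            power4_eq_xxxx)
      also have "T (T x) \<bullet> x = (norm (T x))\<^sup>2"
        using sa by (simp add: op_self_adjoint_def power2_norm_eq_inner)
      also have "(norm (T (T x)))\<^sup>2 \<le> n\<^sup>2 * (norm (T x))\<^sup>2"
        unfolding n_def power_mult_distrib[symmetric] by (intro power_mono norm_blinfun) simp
      finally have normP: "(norm (?P x))\<^sup>2 \<le> n^4 * (norm x)\<^sup>2 - n\<^sup>2 * (norm (T x))\<^sup>2"
        by simp
      have "R (?P x) = x" using R by (metis blinfun_apply_blinfun_compose blinfun_apply_id_blinfun id_apply)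
      then have "norm x \<le> norm R * norm (?P x)" using norm_blinfun[of R "?P x"] by simp
      also have "\<dots> \<le> r * norm (?P x)" by (intro mult_right_mono) (auto simp: r_def)
      finally have "(norm x)\<^sup>2 \<le> (r * norm (?P x))\<^sup>2" by (intro power_mono) auto
      also have "\<dots> \<le> r\<^sup>2 * (n^4 * (norm x)\<^sup>2 - n\<^sup>2 * (norm (T x))\<^sup>2)"
        unfolding power_mult_distrib using normP by (intro mult_left_mono) auto
      also have "\<dots> = n\<^sup>2 * r\<^sup>2 * (n\<^sup>2 * (norm x)\<^sup>2 - (norm (T x))\<^sup>2)"
        by (simp add: algebra_simps power2_eq_square power4_eq_xxxx)
      also have "\<dots> \<le> 2 * n\<^sup>2 * r\<^sup>2 * (n\<^sup>2 * (norm x)\<^sup>2 - (norm (T x))\<^sup>2)"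
      proof -
        have "(norm (T x))\<^sup>2 \<le> n\<^sup>2 * (norm x)\<^sup>2"
          unfolding n_def power_mult_distrib[symmetric] by (intro power_mono norm_blinfun) simp
        then show ?thesis by (intro mult_right_mono) auto
      qed
      finally have "d * (norm x)\<^sup>2 \<le> d * (2 * n\<^sup>2 * r\<^sup>2 * (n\<^sup>2 * (norm x)\<^sup>2 - (norm (T x))\<^sup>2))"
        using d by (intro mult_left_mono) auto
      also have "\<dots> = n\<^sup>2 * (norm x)\<^sup>2 - (norm (T x))\<^sup>2"
        using n r by (simp add: d_def)
      finally show ?thesis by (simp add: algebra_simps)
    qed
    have nd: "n\<^sup>2 - d \<ge> 0"
    proof -
      have "0 \<le> (n\<^sup>2 - d) * (norm v)\<^sup>2" using Tx[of v] by (meson order_trans zero_le_power2)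
      then show ?thesis using nontrivial by (simp add: zero_le_mult_iff)
    qed
    have "norm T \<le> sqrt (n\<^sup>2 - d)"
    proof (rule norm_blinfun_bound)
      fix x
      have "norm (T x) = sqrt ((norm (T x))\<^sup>2)" by simp
      also have "\<dots> \<le> sqrt ((n\<^sup>2 - d) * (norm x)\<^sup>2)" using Tx by (rule real_sqrt_le_mono)
      finally show "norm (T x) \<le> sqrt (n\<^sup>2 - d) * norm x" by (simp add: real_sqrt_mult)
    qed (use nd in simp)
    also have "\<dots> < sqrt (n\<^sup>2)" using d by (intro real_sqrt_less_mono) simp
    finally show False using n by (simp add: n_def)
  qed
  then have "n \<in> op_spectrum T \<or> - n \<in> op_spectrum T"
    using op_invertible_compose unfolding op_spectrum_def by blast
  moreover have "\<bar>n\<bar> = norm T" "\<bar>- n\<bar> = norm T" by (simp_all add: n_def)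
  ultimately show ?thesis by blast
qed

text \<open>A complex root \<open>z\<close> exists and is non-real, and
  \<open>(X - z) (X - conj z)\<close> is the real polynomial \<open>r\<close>. The remainder modulo
  \<open>r\<close> is real, has degree below 2 and vanishes at \<open>z\<close>, so it is
  zero.\<close>

lemma real_poly_quadratic_factor:
  fixes p :: "real poly"
  assumes deg: "degree p \<noteq> 0" and no_root: "\<And>x. poly p x \<noteq> 0"
  obtains a b where "b \<noteq> 0" "[:a\<^sup>2 + b\<^sup>2, - (2 * a), 1:] dvd p"
proof -
  define P where "P = (map_poly of_real p :: complex poly)"
  have eval: "poly (map_poly of_real q) (of_real x) = (of_real (poly q x) :: complex)" for q x
    by (induction q) (auto simp: map_poly_pCons)
  have "\<not> constant (poly P)"
    using deg by (simp add: constant_degree P_def degree_map_poly)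
  then obtain z where z: "poly P z = 0"
    using fundamental_theorem_of_algebra by blast
  define a b where "a = Re z" and "b = Im z"
  have b: "b \<noteq> 0"
  proof
    assume "b = 0"
    then have "z = of_real a" by (simp add: a_def b_def complex_eq_iff)
    with z show False using no_root by (simp add: P_def eval)
  qed
  define r where "r = [:a\<^sup>2 + b\<^sup>2, - (2 * a), 1:]"
  define s where "s = p mod r"
  have "degree s < 2"
    using degree_mod_less[of r p] by (auto simp: s_def r_def)
  then obtain u w where s: "s = [:u, w:]"
  proof -
    have "s = [:coeff s 0, coeff s 1:]"
      using \<open>degree s < 2\<close>
      by (intro poly_eqI) (auto simp: coeff_pCons coeff_eq_0 split: nat.splits)
    then show ?thesis using that by blast
  qed
  have hom_add: "map_poly of_real (f + g) = (map_poly of_real f + map_poly of_real g :: complex poly)" for f g :: "real poly"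
    by (intro poly_eqI) (simp add: coeff_map_poly)
  have hom_mult: "map_poly of_real (f * g) = (map_poly of_real f * map_poly of_real g :: complex poly)" for f g :: "real poly"
    by (intro poly_eqI) (simp add: coeff_map_poly coeff_mult)
  have "P = map_poly of_real (p div r) * map_poly of_real r + map_poly of_real s"
    by (simp add: P_def s_def flip: hom_mult hom_add)
  moreover have "poly (map_poly of_real r) z = 0"
    by (simp add: r_def map_poly_pCons a_def b_def complex_eq_iff power2_eq_square algebra_simps)
  ultimately have "poly (map_poly of_real s) z = 0" using z by simp
  then have "of_real u + z * of_real w = 0" by (simp add: s map_poly_pCons)
  then have "w = 0" "u = 0" using b by (auto simp: complex_eq_iff b_def)
  then have "r dvd p" using s by (simp add: s_def mod_eq_0_iff_dvd)
  with b show ?thesis using that unfolding r_def by blast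
qed

text \<open>Induction on the degree splits off a factor whose value at \<open>A\<close> is
  invertible: a linear one at a real root, which lies outside the spectrum, or else a quadratic
  one.\<close>

lemma op_invertible_op_poly:
  fixes A :: "'a::{real_inner, complete_space} \<Rightarrow>\<^sub>L 'a"
  assumes sa: "op_self_adjoint A" 
  shows "p \<noteq> 0 \<Longrightarrow> (\<And>x. x \<in> op_spectrum A \<Longrightarrow> poly p x \<noteq> 0) \<Longrightarrow> op_invertible (op_poly p A)"
proof (induction "degree p" arbitrary: p rule: less_induct)
  case less
  \<comment> \<open>A nonconstant divisor with invertible value suffices: the cofactor has smaller
    degree and again no zero on the spectrum.\<close>
  have step: "op_invertible (op_poly p A)"
    if "r dvd p" "degree r \<noteq> 0" "op_invertible (op_poly r A)" for r
  proof -
    obtain q where q: "p = r * q" using \<open>r dvd p\<close> by (rule dvdE)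
    then have "q \<noteq> 0" "r \<noteq> 0" using less.prems by auto
    then have "degree q < degree p" using that q by (simp add: degree_mult_eq)
    then have "op_invertible (op_poly q A)"
      using \<open>q \<noteq> 0\<close> less.prems(2) q by (intro less.hyps) auto
    then show ?thesis using that q by (simp add: op_poly_mult op_invertible_compose)
  qed
  consider (const) "degree p = 0" | (root) x where "poly p x = 0"
    | (no_root) "degree p \<noteq> 0" "\<And>x. poly p x \<noteq> 0" by blast
  then show ?case
  proof cases
    case const
    then obtain a where a: "p = [:a:]" by (rule degree_eq_zeroE)
    then have "a \<noteq> 0" using less.prems by auto
    then have "(inverse a *\<^sub>R id_blinfun) o\<^sub>L op_poly p A = id_blinfun"
      "op_poly p A o\<^sub>L (inverse a *\<^sub>R id_blinfun) = id_blinfun"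
      by (auto intro!: blinfun_eqI simp: a op_poly_pCons blinfun.bilinear_simps)
    then show ?thesis unfolding op_invertible_def by blast
  next
    case (root x)
    then have "x \<notin> op_spectrum A" using less.prems by blast
    moreover have "op_poly [:- x, 1:] A = A - x *\<^sub>R id_blinfun"
      by (rule blinfun_eqI) (simp add: op_poly_pCons blinfun.bilinear_simps)
    ultimately show ?thesis
      using root by (intro step[of "[:- x, 1:]"]) (auto simp: poly_eq_0_iff_dvd op_spectrum_def)
  next
    case no_root
    then obtain a b where b: "b \<noteq> 0" and dvd: "[:a\<^sup>2 + b\<^sup>2, - (2 * a), 1:] dvd p"
      by (rule real_poly_quadratic_factor)
    define D where "D = op_poly [:- a, 1:] A"
    have D: "op_self_adjoint D" unfolding D_def by (rule op_self_adjoint_op_poly[OF sa])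
    \<comment> \<open>Completing the square: since \<open>D\<close> is self-adjoint, the quadratic
      form of \<open>D o\<^sub>L D\<close> is \<open>|D x|^2\<close>, so adding \<open>b^2\<close>
      makes the operator coercive.\<close>
    have "[:a\<^sup>2 + b\<^sup>2, - (2 * a), 1:] = [:- a, 1:] * [:- a, 1:] + [:b\<^sup>2:]"
      by (simp add: power2_eq_square)
    then have E: "op_poly [:a\<^sup>2 + b\<^sup>2, - (2 * a), 1:] A = (D o\<^sub>L D) + b\<^sup>2 *\<^sub>R id_blinfun"
      by (simp only: op_poly_add op_poly_mult D_def) (simp add: op_poly_pCons)
    have "op_invertible ((D o\<^sub>L D) + b\<^sup>2 *\<^sub>R id_blinfun)"
    proof (rule op_invertible_if_coercive)
      show "b\<^sup>2 > 0" using b by simp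
      fix x
      have "D (D x) \<bullet> x = D x \<bullet> D x" using D by (simp add: op_self_adjoint_def)
      then show "b\<^sup>2 * (norm x)\<^sup>2 \<le> ((D o\<^sub>L D) + b\<^sup>2 *\<^sub>R id_blinfun) x \<bullet> x"
        by (simp add: blinfun.bilinear_simps inner_add_left power2_norm_eq_inner)
    qed
    then show ?thesis using dvd by (intro step[OF dvd]) (simp_all add: E)
  qed
qed

lemma norm_op_poly_le:
  fixes A :: "'a::{real_inner, complete_space} \<Rightarrow>\<^sub>L 'a"
  assumes sa: "op_self_adjoint A" and "M \<ge> 0"
    and M: "\<And>x. x \<in> op_spectrum A \<Longrightarrow> \<bar>poly q x\<bar> \<le> M"
  shows "norm (op_poly q A) \<le> M"
proof (cases "\<exists>v :: 'a. v \<noteq> 0")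
  case True
  then obtain v :: 'a where v: "v \<noteq> 0" by blast
  \<comment> \<open>For \<open>q = [:c:]\<close> the difference \<open>q - [:c:]\<close> is the zero
    polynomial, to which the invertibility lemma does not apply; there any spectral point
    \<open>y\<close> attains \<open>c\<close>.\<close>
  obtain y where y: "y \<in> op_spectrum A" using norm_in_op_spectrum[OF sa v] by blast
  obtain c where c: "c \<in> op_spectrum (op_poly q A)" "\<bar>c\<bar> = norm (op_poly q A)"
    using norm_in_op_spectrum[OF op_self_adjoint_op_poly[OF sa] v] by blast
  have "op_poly (q - [:c:]) A = op_poly q A - c *\<^sub>R id_blinfun"
    by (simp add: op_poly_diff op_poly_pCons)
  then have not_inv: "\<not> op_invertible (op_poly (q - [:c:]) A)"
    using c by (simp add: op_spectrum_def)
  have "\<exists>x \<in> op_spectrum A. poly q x = c"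
  proof (cases "q = [:c:]")
    case True
    with y show ?thesis by auto
  next
    case False
    then show ?thesis using not_inv op_invertible_op_poly[OF sa, of "q - [:c:]"] by auto
  qed
  with M c show ?thesis by metis
next
  case False
  \<comment> \<open>On the zero space the spectrum is empty, so \<open>M\<close> is controlled by
    \<open>M \<ge> 0\<close> alone.\<close>
  then have "norm (op_poly q A) \<le> 0" by (intro norm_blinfun_bound) auto
  with \<open>M \<ge> 0\<close> show ?thesis by simp
qed

section \<open>Location of the spectrum of a positive operator\<close>

text \<open>For \<open>x < 0\<close> positivity makes \<open>A - x\<close> coercive; for
  \<open>x > norm A\<close> Cauchy-Schwarz makes \<open>x - A\<close> coercive. The interval serves
  as the compact set for polynomial approximation.\<close>

lemma op_spectrum_subset:
  fixes A :: "'a::{real_inner, complete_space} \<Rightarrow>\<^sub>L 'a"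
  assumes "op_positive A"
  shows "op_spectrum A \<subseteq> {0..norm A}"
proof
  fix x assume x: "x \<in> op_spectrum A"
  have "\<not> x < 0"
  proof
    assume "x < 0"
    have "op_invertible (A - x *\<^sub>R id_blinfun)"
    proof (rule op_invertible_if_coercive)
      show "- x > 0" using \<open>x < 0\<close> by simp
      show "- x * (norm h)\<^sup>2 \<le> (A - x *\<^sub>R id_blinfun) h \<bullet> h" for h
        using assms by (simp add: op_positive_def blinfun.bilinear_simps inner_diff_left power2_norm_eq_inner)
    qed
    with x show False by (simp add: op_spectrum_def)
  qed
  moreover have "\<not> x > norm A"
  proof
    assume "x > norm A"
    have "op_invertible (x *\<^sub>R id_blinfun - A)"
    proof (rule op_invertible_if_coercive)
      show "x - norm A > 0" using \<open>x > norm A\<close> by simp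
      fix h
      have "A h \<bullet> h \<le> norm (A h) * norm h" by (rule norm_cauchy_schwarz)
      also have "\<dots> \<le> norm A * norm h * norm h" by (intro mult_right_mono norm_blinfun) simp
      finally show "(x - norm A) * (norm h)\<^sup>2 \<le> (x *\<^sub>R id_blinfun - A) h \<bullet> h"
        by (simp add: blinfun.bilinear_simps inner_diff_left power2_norm_eq_inner[symmetric] power2_eq_square algebra_simps)
    qed
    moreover have "op_invertible ((- 1) *\<^sub>R id_blinfun :: 'a \<Rightarrow>\<^sub>L 'a)"
      unfolding op_invertible_def
      by (rule exI[of _ "(- 1) *\<^sub>R id_blinfun"]) (auto intro!: blinfun_eqI simp: blinfun.bilinear_simps)
    ultimately have "op_invertible ((- 1) *\<^sub>R id_blinfun o\<^sub>L (x *\<^sub>R id_blinfun - A))"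
      by (intro op_invertible_compose)
    also have "(- 1) *\<^sub>R id_blinfun o\<^sub>L (x *\<^sub>R id_blinfun - A) = A - x *\<^sub>R id_blinfun"
      by (auto intro!: blinfun_eqI simp: blinfun.bilinear_simps)
    finally show False using x by (simp add: op_spectrum_def)
  qed
  ultimately show "x \<in> {0..norm A}" by simp
qed

section \<open>Existence and uniqueness of the continuous spectral calculus\<close>

text \<open>The pointwise limit exists as the codomain is complete, and is bounded because Cauchy
  sequences are. Letting one index of the Cauchy estimate tend to infinity gives convergence in
  norm.\<close>

lemma convergent_blinfun_if_Cauchy:
  fixes X :: "nat \<Rightarrow> 'a::real_normed_vector \<Rightarrow>\<^sub>L 'b::{real_normed_vector, complete_space}"
  assumes X: "Cauchy X"
  shows "convergent X"
proof -
  have "convergent (\<lambda>n. X n x)" for x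
  proof (rule Cauchy_convergent)
    have "bounded_linear (\<lambda>f. blinfun_apply f x :: 'b)"
      by (rule blinfun.bounded_linear_left)
    then show "Cauchy (\<lambda>n. X n x)" using X by (rule bounded_linear.Cauchy)
  qed
  then obtain v where v: "\<And>x. (\<lambda>n. X n x) \<longlonglongrightarrow> v x" unfolding convergent_def by metis
  obtain K where K: "\<And>n. norm (X n) \<le> K"
    using Cauchy_Bseq[OF X] by (meson BseqE)
  have bl: "bounded_linear v"
  proof (rule bounded_linear_intro)
    show "v (x + y) = v x + v y" for x y
      using tendsto_add[OF v[of x] v[of y]] v[of "x + y"]
      by (auto intro: LIMSEQ_unique simp: blinfun.add_right)
    show "v (r *\<^sub>R x) = r *\<^sub>R v x" for r x
      using tendsto_scaleR[OF tendsto_const[of r] v[of x]] v[of "r *\<^sub>R x"]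
      by (auto intro: LIMSEQ_unique simp: blinfun.scaleR_right)
    show "norm (v x) \<le> norm x * K" for x
    proof (rule LIMSEQ_le_const2[OF tendsto_norm[OF v]])
      have "norm (X n x) \<le> norm x * K" for n
        using norm_blinfun[of "X n" x] mult_right_mono[OF K[of n] norm_ge_zero[of x]]
        by (simp add: mult.commute)
      then show "\<exists>N. \<forall>n\<ge>N. norm (X n x) \<le> norm x * K" by blast
    qed
  qed
  have "X \<longlonglongrightarrow> Blinfun v"
  proof (rule LIMSEQ_I)
    fix e :: real assume "e > 0"
    then obtain M where M: "\<And>m n. m \<ge> M \<Longrightarrow> n \<ge> M \<Longrightarrow> norm (X m - X n) < e / 2"
      using CauchyD[OF X, of "e / 2"] by auto
    have "norm (X n - Blinfun v) < e" if "n \<ge> M" for n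
    proof -
      have "norm (X n - Blinfun v) \<le> e / 2"
      proof (rule norm_blinfun_bound)
        fix x
        have "norm (X n x - v x) \<le> e / 2 * norm x"
        proof (rule LIMSEQ_le_const2[OF tendsto_norm[OF tendsto_diff[OF tendsto_const v]]])
          have "norm (X n x - X k x) \<le> e / 2 * norm x" if "k \<ge> M" for k
            using norm_blinfun[of "X n - X k" x] M[OF \<open>n \<ge> M\<close> that]
              mult_right_mono[of "norm (X n - X k)" "e / 2" "norm x"]
            by (simp add: blinfun.diff_left)
          then show "\<exists>N. \<forall>k\<ge>N. norm (X n x - X k x) \<le> e / 2 * norm x" by blast
        qed
        then show "norm ((X n - Blinfun v) x) \<le> e / 2 * norm x"
          by (simp add: blinfun.diff_left bounded_linear_Blinfun_apply[OF bl])
      qed (use \<open>e > 0\<close> in simp)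
      then show ?thesis using \<open>e > 0\<close> by simp
    qed
    then show "\<exists>N. \<forall>n\<ge>N. norm (X n - Blinfun v) < e" by blast
  qed
  then show ?thesis by (rule convergentI)
qed

lemma op_poly_tendsto_0:
  fixes A :: "'a::{real_inner, complete_space} \<Rightarrow>\<^sub>L 'a"
  assumes sa: "op_self_adjoint A"
    and lim: "uniform_limit (op_spectrum A) (\<lambda>n. poly (p n)) (\<lambda>_. 0) sequentially"
  shows "(\<lambda>n. op_poly (p n) A) \<longlonglongrightarrow> 0"
proof (rule tendstoI)
  fix e :: real assume "e > 0"
  then have "\<forall>\<^sub>F n in sequentially. \<forall>x\<in>op_spectrum A. dist (poly (p n) x) 0 < e / 2"
    using lim by (intro uniform_limitD) auto
  then show "\<forall>\<^sub>F n in sequentially. dist (op_poly (p n) A) 0 < e"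
  proof eventually_elim
    case (elim n)
    then have "norm (op_poly (p n) A) \<le> e / 2"
      using \<open>e > 0\<close> by (intro norm_op_poly_le[OF sa]) (auto intro: less_imp_le)
    then show ?case using \<open>e > 0\<close> by simp
  qed
qed

text \<open>\<open>op_fun\<close> is a definite description, so its limit must exist and be unique.
  The spectral norm bound makes the sequence Cauchy; the difference of two approximating sequences
  tends to 0 uniformly on the spectrum, so their operator limits agree.\<close>

lemma op_poly_tendsto_op_fun:
  fixes A :: "'a::{real_inner, complete_space} \<Rightarrow>\<^sub>L 'a"
  assumes sa: "op_self_adjoint A"
    and lim: "uniform_limit (op_spectrum A) (\<lambda>n. poly (p n)) g sequentially"
  shows "(\<lambda>n. op_poly (p n) A) \<longlonglongrightarrow> op_fun g A"
proof -
  have "Cauchy (\<lambda>n. op_poly (p n) A)"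
  proof (rule CauchyI)
    fix e :: real assume "e > 0"
    then have "\<forall>\<^sub>F n in sequentially. \<forall>x\<in>op_spectrum A. dist (poly (p n) x) (g x) < e / 4"
      using lim by (intro uniform_limitD) auto
    then obtain N where N: "\<And>n x. n \<ge> N \<Longrightarrow> x \<in> op_spectrum A \<Longrightarrow> dist (poly (p n) x) (g x) < e / 4"
      unfolding eventually_sequentially by blast
    have "norm (op_poly (p m) A - op_poly (p n) A) < e" if "m \<ge> N" "n \<ge> N" for m n
    proof -
      have "norm (op_poly (p m - p n) A) \<le> e / 2"
      proof (rule norm_op_poly_le[OF sa])
        fix x assume "x \<in> op_spectrum A"
        then have "dist (poly (p m) x) (g x) < e / 4" "dist (poly (p n) x) (g x) < e / 4"
          using N that by auto
        then show "\<bar>poly (p m - p n) x\<bar> \<le> e / 2"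
          unfolding dist_real_def poly_diff by linarith
      qed (use \<open>e > 0\<close> in simp)
      then show ?thesis using \<open>e > 0\<close> by (simp add: op_poly_diff)
    qed
    then show "\<exists>N. \<forall>m\<ge>N. \<forall>n\<ge>N. norm (op_poly (p m) A - op_poly (p n) A) < e" by blast
  qed
  then obtain T where T: "(\<lambda>n. op_poly (p n) A) \<longlonglongrightarrow> T"
    using convergent_blinfun_if_Cauchy convergent_def by blast
  have "op_fun g A = T"
    unfolding op_fun_def
  proof (rule the_equality)
    fix T' assume "\<exists>p. uniform_limit (op_spectrum A) (\<lambda>n. poly (p n)) g sequentially \<and>
      (\<lambda>n. op_poly (p n) A) \<longlonglongrightarrow> T'"
    then obtain r where r: "uniform_limit (op_spectrum A) (\<lambda>n. poly (r n)) g sequentially"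
      "(\<lambda>n. op_poly (r n) A) \<longlonglongrightarrow> T'" by blast
    have "uniform_limit (op_spectrum A) (\<lambda>n. poly (p n - r n)) (\<lambda>_. 0) sequentially"
      using uniform_limit_minus[OF lim r(1)] by (simp add: poly_diff[abs_def])
    then have "(\<lambda>n. op_poly (p n - r n) A) \<longlonglongrightarrow> 0" by (rule op_poly_tendsto_0[OF sa])
    moreover have "(\<lambda>n. op_poly (p n - r n) A) \<longlonglongrightarrow> T - T'"
      unfolding op_poly_diff by (intro tendsto_diff T r)
    ultimately show "T' = T" using LIMSEQ_unique by fastforce
  qed (use T lim in blast)
  with T show ?thesis by simp
qed

text \<open>Weierstrass approximation with tolerance \<open>1 / (n + 1)\<close>, in the sequence
  form that \<open>op_fun\<close> asks for.\<close>

lemma continuous_on_uniform_limit_poly: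
  fixes g :: "real \<Rightarrow> real"
  assumes "compact K" "continuous_on K g"
  obtains p where "uniform_limit K (\<lambda>n. poly (p n)) g sequentially"
proof -
  have "\<exists>q. \<forall>x\<in>K. \<bar>g x - poly q x\<bar> < e" if "e > 0" for e
  proof -
    obtain h where h: "real_polynomial_function h" "\<And>x. x \<in> K \<Longrightarrow> \<bar>g x - h x\<bar> < e"
      using Stone_Weierstrass_real_polynomial_function[OF assms \<open>e > 0\<close>] by blast
    then obtain a n where "h = (\<lambda>x. \<Sum>i\<le>n. a i * x ^ i)"
      unfolding real_polynomial_function_iff_sum by blast
    then have "h x = poly (\<Sum>i\<le>n. monom (a i) i) x" for x
      by (simp add: poly_sum poly_monom)
    with h show ?thesis by metis
  qed
  then have "\<exists>q. \<forall>x\<in>K. \<bar>g x - poly q x\<bar> < inverse (real (Suc n))" for n by simp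
  then obtain p where p: "\<And>n x. x \<in> K \<Longrightarrow> \<bar>g x - poly (p n) x\<bar> < inverse (real (Suc n))"
    by metis
  have "uniform_limit K (\<lambda>n. poly (p n)) g sequentially"
  proof (rule uniform_limitI)
    fix e :: real assume "e > 0"
    then have "\<forall>\<^sub>F n in sequentially. inverse (real (Suc n)) < e"
      using LIMSEQ_inverse_real_of_nat by (simp add: order_tendstoD)
    then show "\<forall>\<^sub>F n in sequentially. \<forall>x\<in>K. dist (poly (p n) x) (g x) < e"
    proof eventually_elim
      case (elim n)
      show ?case
      proof
        fix x assume "x \<in> K"
        from p[OF this, of n] elim show "dist (poly (p n) x) (g x) < e"
          unfolding dist_real_def by linarith
      qed
    qed
  qed
  then show ?thesis using that by blast
qed

section \<open>Quadratic form of the square root\<close>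

text \<open>If \<open>p n\<close> approximates the square root, then \<open>p n * p n\<close>
  approximates the identity function, so the square of \<open>op_poly (p n) B\<close> tends to
  \<open>B\<close>. By self-adjointness the quadratic form of that square at \<open>x\<close> is the
  squared norm of \<open>op_poly (p n) B x\<close>.\<close>

lemma norm_op_powr_half:
  fixes B :: "'a::{real_inner, complete_space} \<Rightarrow>\<^sub>L 'a"
  assumes sa: "op_self_adjoint B" and pos: "op_positive B"
  shows "norm (op_powr B (1/2) x) = sqrt (B x \<bullet> x)"
proof -
  define g where "g = (\<lambda>x::real. x powr (1/2))"
  \<comment> \<open>Approximation takes place on this compact interval and is then restricted to the
    spectrum.\<close>
  define K where "K = {0..norm B}"
  have sub: "op_spectrum B \<subseteq> K" unfolding K_def by (rule op_spectrum_subset[OF pos])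
  have g_sqrt: "g x = sqrt x" if "x \<in> K" for x
    using that by (simp add: g_def K_def powr_half_sqrt)
  have g: "continuous_on K g" "\<And>x. x \<in> K \<Longrightarrow> g x * g x = x"
    using continuous_on_cong[OF refl g_sqrt, of K] continuous_on_real_sqrt[OF continuous_on_id, of K] g_sqrt
    by (auto simp: K_def)
  obtain p where p: "uniform_limit K (\<lambda>n. poly (p n)) g sequentially"
    using continuous_on_uniform_limit_poly[OF _ g(1)] unfolding K_def by blast
  have T: "(\<lambda>n. op_poly (p n) B) \<longlonglongrightarrow> op_powr B (1/2)"
    unfolding op_powr_def g_def[symmetric]
    by (rule op_poly_tendsto_op_fun[OF sa uniform_limit_on_subset[OF p sub]])
  \<comment> \<open>Boundedness of \<open>g\<close> is what allows the uniform limits to be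
    multiplied.\<close>
  have bdd: "bounded (g ` K)"
    using g(1) by (intro compact_imp_bounded compact_continuous_image) (auto simp: K_def)
  have "uniform_limit K (\<lambda>n x. poly (p n) x * poly (p n) x) (\<lambda>x. g x * g x) sequentially"
    by (rule uniform_lim_mult[OF p p bdd bdd])
  then have "uniform_limit K (\<lambda>n x. poly (p n) x * poly (p n) x) (\<lambda>x. x) sequentially"
    by (rule uniform_limit_cong'[THEN iffD1, rotated -1]) (auto simp: g(2))
  from uniform_limit_minus[OF this uniform_limit_const[where c = "\<lambda>x. x"]]
  have "uniform_limit K (\<lambda>n. poly (p n * p n - [:0, 1:])) (\<lambda>_. 0) sequentially"
    by (simp add: poly_diff[abs_def] mult.commute)
  then have "(\<lambda>n. op_poly (p n * p n - [:0, 1:]) B) \<longlonglongrightarrow> 0"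
    by (intro op_poly_tendsto_0[OF sa]) (rule uniform_limit_on_subset[OF _ sub])
  then have "(\<lambda>n. op_poly (p n * p n - [:0, 1:]) B x \<bullet> x) \<longlonglongrightarrow> (0 :: 'a \<Rightarrow>\<^sub>L 'a) x \<bullet> x"
    by (intro tendsto_intros)
  moreover have "op_poly (p n * p n - [:0, 1:]) B x \<bullet> x = (norm (op_poly (p n) B x))\<^sup>2 - B x \<bullet> x" for n
  proof -
    have "op_poly (p n) B (op_poly (p n) B x) \<bullet> x = (norm (op_poly (p n) B x))\<^sup>2"
      using op_self_adjoint_op_poly[OF sa] by (simp add: op_self_adjoint_def power2_norm_eq_inner)
    then show ?thesis
      by (simp add: op_poly_diff op_poly_mult op_poly_X blinfun.diff_left inner_diff_left)
  qed
  ultimately have 1: "(\<lambda>n. (norm (op_poly (p n) B x))\<^sup>2 - B x \<bullet> x) \<longlonglongrightarrow> 0" by simp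
  have "(\<lambda>n. (norm (op_poly (p n) B x))\<^sup>2 - B x \<bullet> x) \<longlonglongrightarrow> (norm (op_powr B (1/2) x))\<^sup>2 - B x \<bullet> x"
    by (intro tendsto_intros T)
  with 1 have "(norm (op_powr B (1/2) x))\<^sup>2 = B x \<bullet> x"
    using LIMSEQ_unique by fastforce
  then show ?thesis by (metis norm_ge_zero real_sqrt_unique)
qed

text \<open>This transfers an error bound in the norm at one grid point to the weaker norm at a
  smaller one.\<close>

lemma norm_op_powr_half_shift_mono:
  fixes A :: "'a::{real_inner, complete_space} \<Rightarrow>\<^sub>L 'a"
  assumes sa: "op_self_adjoint A" and pos: "op_positive A" and "0 \<le> l" "l \<le> l'"
  shows "norm (op_powr (A + l *\<^sub>R id_blinfun) (1/2) x) \<le> norm (op_powr (A + l' *\<^sub>R id_blinfun) (1/2) x)"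
proof -
  have "norm (op_powr (A + r *\<^sub>R id_blinfun) (1/2) x) = sqrt (A x \<bullet> x + r * (x \<bullet> x))" if "r \<ge> 0" for r
  proof -
    have "op_self_adjoint (A + r *\<^sub>R id_blinfun)" "op_positive (A + r *\<^sub>R id_blinfun)"
      using sa pos that
      by (auto simp: op_self_adjoint_def op_positive_def blinfun.bilinear_simps inner_add_left inner_add_right)
    then show ?thesis
      by (subst norm_op_powr_half) (auto simp: blinfun.bilinear_simps inner_add_left)
  qed
  then show ?thesis using assms by (simp add: mult_right_mono)
qed

section \<open>Lepskii's balancing argument\<close>

text \<open>For \<open>s \<le> 1/2\<close> the function is a product of two nonnegative
  non-increasing ones, \<open>z powr (s - 1/2)\<close> and \<open>sqrt z * S z\<close>.\<close>

lemma powr_mult_antimono: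
  fixes S :: "real \<Rightarrow> real"
  assumes anti: "antimono_on {0<..b} (\<lambda>l. sqrt l * S l)"
    and "0 < x" "x \<le> y" "y \<le> b" "s \<le> 1/2" "S y \<ge> 0"
  shows "y powr s * S y \<le> x powr s * S x"
proof -
  have eq: "z powr s * S z = z powr (s - 1/2) * (sqrt z * S z)" if "z > 0" for z
    using that by (simp add: powr_diff powr_half_sqrt)
  have "y powr (s - 1/2) * (sqrt y * S y) \<le> x powr (s - 1/2) * (sqrt x * S x)"
  proof (rule mult_mono)
    show "y powr (s - 1/2) \<le> x powr (s - 1/2)"
      using assms by (intro powr_mono2') auto
    show "sqrt y * S y \<le> sqrt x * S x"
      using assms by (intro monotone_onD[OF anti]) auto
  qed (use assms in auto)
  then show ?thesis unfolding eq[OF \<open>0 < x\<close>] eq[OF less_le_trans[OF \<open>0 < x\<close> \<open>x \<le> y\<close>]] .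
qed

theorem theorem3p2:
  fixes A :: "'a::{real_inner, complete_space} \<Rightarrow>\<^sub>L 'a"
    and f_rho :: 'a
    and f :: "real \<Rightarrow> 'a"
    and \<kappa> C :: real
    and m :: nat
    and lam :: "nat \<Rightarrow> real"
    and \<Lambda> :: "real set"
    and App S :: "real \<Rightarrow> real"
  assumes kappa: "\<kappa> > 0"
    and m: "m \<ge> 1"
    and grid: "\<Lambda> = lam ` {0..m}"
    and grid_top: "lam 0 \<le> \<kappa>\<^sup>2"
    and grid_decreasing: "\<And>k. k < m \<Longrightarrow> lam (Suc k) < lam k"
    and grid_pos: "lam m > 0"
    and A_self_adjoint: "op_self_adjoint A"
    and A_positive: "op_positive A"
    and C: "C > 0"
    and App_nonneg: "\<And>l. l \<in> {0..\<kappa>\<^sup>2} \<Longrightarrow> App l \<ge> 0"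
    and App_mono: "mono_on {0..\<kappa>\<^sup>2} App"
    and App_zero: "App 0 = 0"
    and S_nonneg: "\<And>l. l \<in> {0..\<kappa>\<^sup>2} \<Longrightarrow> S l \<ge> 0"
    and S_antimono: "antimono_on {0<..\<kappa>\<^sup>2} (\<lambda>l. sqrt l * S l)"
    and approx: "\<And>l. l \<in> \<Lambda> \<Longrightarrow>
      norm (blinfun_apply (op_powr (A + l *\<^sub>R id_blinfun) (1/2)) (f_rho - f l))
        \<le> C * sqrt l * (App l + S l)"
  shows "(lambda_hat A C S f \<Lambda> \<ge> lambda_star App S \<Lambda> \<and>
          norm (blinfun_apply (op_powr (A + lambda_star App S \<Lambda> *\<^sub>R id_blinfun) (1/2))
                  (f_rho - f (lambda_hat A C S f \<Lambda>)))
            \<le> 6 * C * sqrt (lambda_star App S \<Lambda>) * S_tilde App S (lambda_star App S \<Lambda>)) \<and>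
         (\<forall>C_S > 1. (\<forall>k \<in> {1..m}. S (lam k) \<le> C_S * S (lam (k - 1))) \<longrightarrow>
            (\<forall>s \<in> {0..1/2}.
               lambda_star App S \<Lambda> powr s * S_tilde App S (lambda_star App S \<Lambda>)
                 \<le> C_S * (INF l \<in> {lam m..lam 0}. l powr s * (App l + S l))))"
proof -
  define ls where "ls = lambda_star App S \<Lambda>"
  define lh where "lh = lambda_hat A C S f \<Lambda>"
  \<comment> \<open>The argument treats \<open>N l\<close> as a family of seminorms that grow with
    \<open>l\<close>.\<close>
  define N where "N l x = norm (op_powr (A + l *\<^sub>R id_blinfun) (1/2) x)" for l x
  have N_diff: "N l (x - y) \<le> N l x + N l y" for l x y
    unfolding N_def blinfun.diff_right by (rule norm_triangle_ineq4)
  have N_mono: "N l x \<le> N l' x" if "0 \<le> l" "l \<le> l'" for l l' x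
    unfolding N_def by (rule norm_op_powr_half_shift_mono[OF A_self_adjoint A_positive that])
  have lam_mono: "lam j \<le> lam i" if "i \<le> j" "j \<le> m" for i j
    using that
  proof (induction j rule: dec_induct)
    case (step n)
    then show ?case using grid_decreasing[of n] by simp
  qed simp
  have fin: "finite \<Lambda>" by (simp add: grid)
  have grid_bounds: "lam m \<le> l" "l \<le> lam 0" if "l \<in> \<Lambda>" for l
    using that lam_mono by (auto simp: grid)
  have min: "Min \<Lambda> = lam m"
    using fin by (intro Min_eqI) (auto simp: grid_bounds grid)
  have S_pos: "S l \<ge> 0" and App_pos: "App l \<ge> 0" if "lam m \<le> l" "l \<le> lam 0" for l
    using that grid_pos grid_top by (auto intro!: S_nonneg App_nonneg)
  have App_le: "App l \<le> App l'" if "lam m \<le> l" "l \<le> l'" "l' \<le> lam 0" for l l'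
    using that grid_pos grid_top by (intro mono_onD[OF App_mono]) auto
  have powr_S_le: "l' powr s * S l' \<le> l powr s * S l"
    if "lam m \<le> l" "l \<le> l'" "l' \<le> lam 0" "s \<le> 1/2" for l l' s
    using that grid_pos grid_top S_pos by (intro powr_mult_antimono[OF S_antimono]) auto
  have ls_mem: "ls \<in> {l \<in> \<Lambda>. App l \<le> S l} \<union> {lam m}"
    unfolding ls_def lambda_star_def min using fin by (intro Max_in) auto
  have ls_max: "l \<le> ls" if "l \<in> \<Lambda>" "App l \<le> S l" for l
    unfolding ls_def lambda_star_def using fin that by (intro Max_ge) auto
  have ls: "ls \<in> \<Lambda>" using ls_mem by (auto simp: grid)
  note ls_bounds = grid_bounds[OF ls]
  have ls_pos: "ls > 0" using ls_bounds grid_pos by simp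
  have approx': "N l (f_rho - f l) \<le> C * (sqrt l * App l + sqrt l * S l)" if "l \<in> \<Lambda>" for l
    using approx[OF that] by (simp add: N_def algebra_simps)

  have ls_adm: "ls \<in> admissible_set A C S f \<Lambda>"
    unfolding admissible_set_def N_def[symmetric]
  proof (intro CollectI conjI ls ballI impI)
    fix l assume l: "l \<in> \<Lambda>" "l \<le> ls"
    note l_bounds = grid_bounds[OF l(1)]
    have l_pos: "l > 0" using l_bounds grid_pos by simp
    show "N l (f ls - f l) \<le> 4 * C * sqrt l * S l"
    \<comment> \<open>At the smallest grid point \<open>App\<close> may exceed \<open>S\<close>, but
      there \<open>l = ls\<close> is the only comparison and the difference is zero.\<close>
    proof (cases "ls = lam m")
      case True
      then have "ls = l" using l l_bounds by simp
      then show ?thesis using C l_pos S_pos[OF l_bounds] by (simp add: N_def)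
    next
      case False
      then have "App ls \<le> S ls" using ls_mem by auto
      have S_le: "sqrt ls * S ls \<le> sqrt l * S l"
        using powr_S_le[of l ls "1/2"] l l_bounds ls_bounds l_pos ls_pos
        by (simp add: powr_half_sqrt)
      have App_ls: "sqrt ls * App ls \<le> sqrt l * S l"
      proof -
        have "sqrt ls * App ls \<le> sqrt ls * S ls"
          using \<open>App ls \<le> S ls\<close> ls_pos by (intro mult_left_mono) auto
        with S_le show ?thesis by linarith
      qed
      have "sqrt l * App l \<le> sqrt ls * App ls"
        using App_le[of l ls] App_pos[of l] l l_bounds ls_bounds l_pos by (intro mult_mono) auto
      then have App_l: "sqrt l * App l \<le> sqrt l * S l" using App_ls by linarith
      have "N l (f ls - f l) = N l ((f_rho - f l) - (f_rho - f ls))" by simp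
      also have "\<dots> \<le> N l (f_rho - f l) + N l (f_rho - f ls)" by (rule N_diff)
      also have "\<dots> \<le> N l (f_rho - f l) + N ls (f_rho - f ls)"
        using N_mono l l_pos by simp
      also have "\<dots> \<le> C * (sqrt l * App l + sqrt l * S l) + C * (sqrt ls * App ls + sqrt ls * S ls)"
        using approx' l ls by (intro add_mono) auto
      \<comment> \<open>Monotonicity of \<open>App\<close> and of \<open>sqrt l * S l\<close> bounds
        each of the four terms by \<open>sqrt l * S l\<close>; hence the 4 in the admissible
        set.\<close>
      also have "\<dots> \<le> C * (sqrt l * S l + sqrt l * S l) + C * (sqrt l * S l + sqrt l * S l)"
        using C by (intro add_mono mult_left_mono S_le App_ls App_l order_refl less_imp_le)
      finally show ?thesis by (simp add: algebra_simps)
    qed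
  qed
  have adm_fin: "finite (admissible_set A C S f \<Lambda>)"
    using fin by (simp add: admissible_set_def)
  have lh_ge: "ls \<le> lh"
    unfolding lh_def lambda_hat_def by (rule Max_ge[OF adm_fin ls_adm])
  have "lh \<in> admissible_set A C S f \<Lambda>"
    unfolding lh_def lambda_hat_def using adm_fin ls_adm by (intro Max_in) auto
  then have lh_adm: "N ls (f lh - f ls) \<le> 4 * C * sqrt ls * S ls"
    using ls lh_ge by (auto simp: admissible_set_def N_def)
  \<comment> \<open>Admissibility of \<open>lh\<close> is used at \<open>ls\<close>, which it
    dominates. The constant arises as 1 from \<open>App\<close> and 1 + 4 from \<open>S\<close>,
    both bounded by \<open>S_tilde\<close>.\<close>
  have "N ls (f_rho - f lh) = N ls ((f_rho - f ls) - (f lh - f ls))" by simp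
  also have "\<dots> \<le> N ls (f_rho - f ls) + N ls (f lh - f ls)" by (rule N_diff)
  also have "\<dots> \<le> C * sqrt ls * (App ls + S ls) + 4 * C * sqrt ls * S ls"
    using approx[OF ls] lh_adm by (simp add: N_def)
  also have "\<dots> = C * sqrt ls * (App ls + 5 * S ls)" by (simp add: algebra_simps)
  also have "\<dots> \<le> C * sqrt ls * (6 * S_tilde App S ls)"
    using C ls_pos by (intro mult_left_mono) (auto simp: S_tilde_def)
  finally have part1: "N ls (f_rho - f lh) \<le> 6 * C * sqrt ls * S_tilde App S ls" by simp

  \<comment> \<open>Comparison with the infimum over the whole interval\<close>
  have part2: "ls powr s * S_tilde App S ls \<le> C_S * (INF l \<in> {lam m..lam 0}. l powr s * (App l + S l))"
    if C_S: "C_S > 1" and ratio: "\<forall>k \<in> {1..m}. S (lam k) \<le> C_S * S (lam (k - 1))"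
      and s: "s \<in> {0..1/2}" for C_S s
  proof -
    have bound: "ls powr s * S_tilde App S ls \<le> C_S * (l powr s * (App l + S l))"
      if l: "lam m \<le> l" "l \<le> lam 0" for l
    proof -
      have l_pos: "l > 0" using l grid_pos by simp
      define R where "R = l powr s * (App l + S l)"
      have R: "l powr s * App l \<le> R" "l powr s * S l \<le> R"
        using App_pos[OF l] S_pos[OF l] by (auto simp: R_def algebra_simps)
      have "R \<ge> 0" using App_pos[OF l] S_pos[OF l] by (simp add: R_def)
      \<comment> \<open>Bounds obtained without a step along the grid are relaxed by the factor
        \<open>C_S\<close> so that all cases match.\<close>
      then have R': "R \<le> C_S * R" using C_S mult_right_mono[of 1 C_S R] by simp
      have App_bound: "ls powr s * App ls \<le> R" if "ls \<le> l"
      proof -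
        have "ls powr s * App ls \<le> l powr s * App l"
          using that s ls_pos App_le[OF ls_bounds(1) that l(2)] App_pos[OF ls_bounds]
          by (intro mult_mono powr_mono2) auto
        with R show ?thesis by simp
      qed
      have S_bound: "ls powr s * S ls \<le> C_S * R"
      proof (cases "l \<le> ls")
        case True
        then have "ls powr s * S ls \<le> l powr s * S l"
          using l ls_bounds s by (intro powr_S_le) auto
        with R R' show ?thesis by simp
      next
        case False
        obtain k where k: "k \<le> m" "ls = lam k" using ls by (auto simp: grid)
        \<comment> \<open>Here \<open>ls < l \<le> lam 0\<close>, so \<open>ls\<close> has a
          predecessor \<open>u\<close> in the grid. It lies above \<open>ls\<close>, so maximality
          of \<open>ls\<close> gives \<open>S u \<le> App u\<close>, and passing from
          \<open>S ls\<close> to \<open>S u\<close> costs \<open>C_S\<close>.\<close>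
        have "k \<noteq> 0" using False l k by metis
        define u where "u = lam (k - 1)"
        have u: "u \<in> \<Lambda>" using k by (auto simp: u_def grid)
        have "ls < u" using grid_decreasing[of "k - 1"] k \<open>k \<noteq> 0\<close> by (simp add: u_def)
        then have "S u \<le> App u" using ls_max[OF u] by force
        have ratio_u: "S ls \<le> C_S * S u" using ratio k \<open>k \<noteq> 0\<close> by (auto simp: u_def)
        have "ls powr s * S u \<le> l powr s * S u"
          using False s ls_pos S_pos[OF grid_bounds[OF u]]
          by (intro mult_right_mono powr_mono2) auto
        \<comment> \<open>The point \<open>l\<close> need not belong to the grid. If
          \<open>u \<le> l\<close>, then \<open>S u \<le> App u \<le> App l\<close>; otherwise the
          monotonicity of \<open>z powr s * S z\<close> leads from \<open>u\<close> down to
          \<open>l\<close>.\<close>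
        also have "\<dots> \<le> R"
        proof (cases "u \<le> l")
          case True
          then have "S u \<le> App l"
            using \<open>S u \<le> App u\<close> App_le[OF grid_bounds(1)[OF u] True l(2)] by simp
          then have "l powr s * S u \<le> l powr s * App l" by (intro mult_left_mono) auto
          with R show ?thesis by simp
        next
          case False
          then have "l powr s * S u \<le> u powr s * S u"
            using s l_pos S_pos[OF grid_bounds[OF u]] by (intro mult_right_mono powr_mono2) auto
          also have "\<dots> \<le> l powr s * S l"
            using False l grid_bounds[OF u] s by (intro powr_S_le) auto
          finally show ?thesis using R by simp
        qed
        finally have "C_S * (ls powr s * S u) \<le> C_S * R"
          using C_S by (intro mult_left_mono) auto
        moreover have "ls powr s * S ls \<le> ls powr s * (C_S * S u)"
          using ratio_u by (intro mult_left_mono) auto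
        ultimately show ?thesis by (simp add: algebra_simps)
      qed
      show ?thesis
      proof (cases "App ls \<le> S ls")
        case True
        then show ?thesis using S_bound by (simp add: S_tilde_def R_def)
      next
        case False
        \<comment> \<open>\<open>App\<close> exceeds \<open>S\<close> at \<open>ls\<close> only if
          \<open>ls\<close> is the smallest grid point, which bounds \<open>l\<close> from
          below.\<close>
        then have "ls \<le> l" using ls_mem l by auto
        then show ?thesis using False App_bound R' by (simp add: S_tilde_def R_def)
      qed
    qed
    have "lam m \<le> lam 0" using lam_mono by simp
    \<comment> \<open>Dividing by \<open>C_S\<close> turns the pointwise estimate into a lower bound
      independent of \<open>l\<close>.\<close>
    have "ls powr s * S_tilde App S ls / C_S \<le> (INF l \<in> {lam m..lam 0}. l powr s * (App l + S l))"
      using bound C_S \<open>lam m \<le> lam 0\<close>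
      by (intro cINF_greatest) (auto simp: divide_le_eq mult.commute)
    then show ?thesis using C_S by (simp add: divide_le_eq mult.commute)
  qed
  show ?thesis
    using lh_ge part1 part2 unfolding ls_def lh_def N_def by blast
qed

end
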